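(* Let $K$ be a field and let $I$ be a proper squarefree monomial ideal in $S=K[x_1,\ldots,x_n]$, minimally generated by monomials $u_1,\ldots,u_s$ ($s\ge 1$) with $1\leq d=\deg(u_1)\leq\cdots\leq\deg(u_s)$. For all $d\leq i\leq n$ let $a_i$ be the number of squarefree monomials of degree $i$ in $I$, and set $f(t):=\sum_{i=d}^n a_it^i$. Then: (1) $H_I(t)=\sum_{i=d}^n\frac{a_it^i}{(1-t)^i}$ and $\mathrm{hdepth}(I)\geq d$. (2) If $f(t)=\sum_j b_jt^{\alpha_j}(1+t)^{\beta_j}$ (a finite sum) with $b_j\in\mathbb{Z}_{>0}$, integers $\alpha_j\geq d$, and $\beta_j\in\mathbb{Z}_{\geq 0}$, then $$H_I(t)=\sum_j\frac{b_jt^{\alpha_j}}{(1-t)^{\alpha_j+\beta_j}}\quad\text{and}\quad \mathrm{hdepth}(I)\geq\min_j\{\alpha_j+\beta_j\}.$$ (3) If $\mathrm{hdepth}(I)\geq p$ with $d\leq p\leq n$, then there exist unique $b_d,\ldots,b_p\in\mathbb{Z}_{\geq 0}$ such that $$f(t)=\left(\sum_{i=d}^p b_it^i(1+t)^{p-i}\right)+a_{p+1}t^{p+1}+\cdots+a_nt^n,$$ and then $$H_I(t)=\frac{b_dt^d+b_{d+1}t^{d+1}+\cdots+b_pt^p}{(1-t)^p}+\frac{a_{p+1}t^{p+1}}{(1-t)^{p+1}}+\cdots+\frac{a_nt^n}{(1-t)^n}.$$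
   Context: $S=K[x_1,\ldots,x_n]$ is $\mathbb{Z}$-graded with $\deg(x_i)=1$, and $H_I(t)=\sum_{k}\dim_K(I_k)\,t^k$ is the Hilbert series of a graded ideal $I$. A Hilbert decomposition of a graded ideal $I$ is an isomorphism of graded $K$-vector spaces $\mathcal{H}: I\cong\bigoplus_{i=1}^m K[Z_i](-s_i)$ with $s_i\in\mathbb{Z}_{\geq 0}$ and $Z_i\subset\{x_1,\ldots,x_n\}$ (equivalently, $H_I(t)=\sum_{i=1}^m t^{s_i}/(1-t)^{|Z_i|}$). Its Hilbert depth is $\mathrm{hdepth}(\mathcal{H})=\min_i|Z_i|$, and $\mathrm{hdepth}(I)$ is the maximum of $\mathrm{hdepth}(\mathcal{H})$ over all Hilbert decompositions $\mathcal{H}$ of $I$. *)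

theory Defs
  imports
    "HOL-Library.Poly_Mapping"
    "HOL-Library.FuncSet"
    "HOL-Library.Cardinality"
    "HOL-Computational_Algebra.Polynomial"
    "HOL-Computational_Algebra.Formal_Power_Series"
begin

text \<open>
  The variables of the polynomial ring $S = K[x_1,\ldots,x_n]$ are the elements of a finite type
  \<open>'x\<close>, so that $n$ is \<open>CARD('x)\<close>. Monomials are represented by their exponent vectors.
\<close>

type_synonym 'x mon = "'x \<Rightarrow>\<^sub>0 nat"
type_synonym ('x, 'k) mpoly = "'x mon \<Rightarrow>\<^sub>0 'k"

definition deg :: "('x::finite) mon \<Rightarrow> nat" where
  "deg w = (\<Sum>x\<in>UNIV. Poly_Mapping.lookup w x)"

definition sqfree_mon :: "'x mon \<Rightarrow> bool" where
  "sqfree_mon w \<longleftrightarrow> (\<forall>x. Poly_Mapping.lookup w x \<le> 1)"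

definition monomial :: "'x mon \<Rightarrow> ('x, 'k::field) mpoly" where
  "monomial w = Poly_Mapping.single w 1"

definition scale :: "'k::field \<Rightarrow> ('x, 'k) mpoly \<Rightarrow> ('x, 'k) mpoly" where
  "scale c p = Poly_Mapping.single 0 c * p"

lemma module_mpoly: "module ((*) :: ('x, 'k::field) mpoly \<Rightarrow> _ \<Rightarrow> _)"
  by unfold_locales (simp_all add: algebra_simps)

lemma vector_space_mpoly: "vector_space (scale :: 'k::field \<Rightarrow> ('x, 'k) mpoly \<Rightarrow> _)"
  by unfold_locales
    (simp_all add: scale_def algebra_simps single_add mult_single flip: mult.assoc)

definition mon_ideal :: "'x mon set \<Rightarrow> ('x, 'k::field) mpoly set" where
  "mon_ideal G = module.span (*) (monomial ` G)"

definition sqfree_monomial_ideal :: "('x, 'k::field) mpoly set \<Rightarrow> bool" where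
  "sqfree_monomial_ideal I \<longleftrightarrow> (\<exists>G. (\<forall>w\<in>G. sqfree_mon w) \<and> I = mon_ideal G)"

text \<open>
  The family $u_1,\ldots,u_s$ generates \<open>I\<close>, and no generator can be omitted
  (in particular the \<open>u j\<close> are pairwise distinct).
\<close>

definition min_generated_by ::
    "('x, 'k::field) mpoly set \<Rightarrow> nat \<Rightarrow> (nat \<Rightarrow> 'x mon) \<Rightarrow> bool" where
  "min_generated_by I s u \<longleftrightarrow>
     I = mon_ideal (u ` {1..s}) \<and> (\<forall>j\<in>{1..s}. mon_ideal (u ` ({1..s} - {j})) \<noteq> I)"

definition homogeneous :: "nat \<Rightarrow> ('x::finite, 'k::field) mpoly set" where
  "homogeneous k = {p. \<forall>w\<in>Poly_Mapping.keys p. deg w = k}"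

text \<open>The series is taken over \<open>rat\<close> so that it can be compared with quotients by $(1-t)^i$.\<close>

definition hilbert_series :: "('x::finite, 'k::field) mpoly set \<Rightarrow> rat fps" where
  "hilbert_series I = Abs_fps (\<lambda>k. of_nat (vector_space.dim scale (I \<inter> homogeneous k)))"

definition subpolys :: "'x set \<Rightarrow> ('x, 'k::field) mpoly set" where
  "subpolys Z = {p. \<forall>w\<in>Poly_Mapping.keys p. Poly_Mapping.keys w \<subseteq> Z}"

text \<open>
  Component of degree \<open>k\<close> of the shifted space $K[Z](-s)$, that is, $K[Z]_{k-s}$;
  it is zero for \<open>k < s\<close>.
\<close>

definition shifted_comp :: "'x::finite set \<Rightarrow> nat \<Rightarrow> nat \<Rightarrow> ('x, 'k::field) mpoly set" where
  "shifted_comp Z s k = {p \<in> subpolys Z. \<forall>w\<in>Poly_Mapping.keys p. deg w + s = k}"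

text \<open>
  A list \<open>[(Z_1, s_1), \<dots>, (Z_m, s_m)]\<close> encodes the graded space $\bigoplus_i K[Z_i](-s_i)$, whose
  elements are the extensional families indexed by the positions \<open>{..<m}\<close> of the list.
\<close>

type_synonym 'x decomp = "('x set \<times> nat) list"

definition direct_sum :: "'x decomp \<Rightarrow> (nat \<Rightarrow> ('x, 'k::field) mpoly) set" where
  "direct_sum D = (\<Pi>\<^sub>E i\<in>{..<length D}. subpolys (fst (D ! i)))"

definition direct_sum_comp ::
    "('x::finite) decomp \<Rightarrow> nat \<Rightarrow> (nat \<Rightarrow> ('x, 'k::field) mpoly) set" where
  "direct_sum_comp D k = (\<Pi>\<^sub>E i\<in>{..<length D}. shifted_comp (fst (D ! i)) (snd (D ! i)) k)"

definition graded_iso ::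
    "(('x::finite, 'k::field) mpoly \<Rightarrow> nat \<Rightarrow> ('x, 'k) mpoly) \<Rightarrow>
     ('x, 'k) mpoly set \<Rightarrow> 'x decomp \<Rightarrow> bool" where
  "graded_iso \<phi> I D \<longleftrightarrow>
     bij_betw \<phi> I (direct_sum D) \<and>
     (\<forall>p\<in>I. \<forall>q\<in>I. \<forall>i<length D. \<phi> (p + q) i = \<phi> p i + \<phi> q i) \<and>
     (\<forall>c. \<forall>p\<in>I. \<forall>i<length D. \<phi> (scale c p) i = scale c (\<phi> p i)) \<and>
     (\<forall>k. \<phi> ` (I \<inter> homogeneous k) = direct_sum_comp D k)"

definition hilbert_decomp :: "('x::finite, 'k::field) mpoly set \<Rightarrow> 'x decomp \<Rightarrow> bool" where
  "hilbert_decomp I D \<longleftrightarrow> (\<exists>\<phi>. graded_iso \<phi> I D)"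

definition decomp_depth :: "'x decomp \<Rightarrow> nat" where
  "decomp_depth D = Min (card ` fst ` set D)"

text \<open>
  Meaningful for graded \<open>I \<noteq> {0}\<close>: decompositions of such an ideal are nonempty lists, and the
  depths are bounded by \<open>CARD('x)\<close>.
\<close>

definition hdepth :: "('x::finite, 'k::field) mpoly set \<Rightarrow> nat" where
  "hdepth I = Max {decomp_depth D | D. hilbert_decomp I D}"

definition num_sqfree :: "('x::finite, 'k::field) mpoly set \<Rightarrow> nat \<Rightarrow> nat" where
  "num_sqfree I i = card {w. sqfree_mon w \<and> deg w = i \<and> monomial w \<in> I}"

end

theory Submission
  imports Defs
begin

text \<open>
  Sorting the monomials of \<open>I\<close> by their radical gives \<open>H_I(t) = f(t / (1 - t))\<close>. Since
  \<open>1 + t / (1 - t) = 1 / (1 - t)\<close>, the substitution \<open>t \<mapsto> t / (1 - t)\<close> sends \<open>t^\<alpha> (1 + t)^\<beta>\<close> to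
  \<open>t^\<alpha> / (1 - t)^(\<alpha> + \<beta>)\<close>, so expansions of \<open>f\<close> become expansions of \<open>H_I\<close>, and the latter
  come from Hilbert decompositions because a bijection between the monomial bases in each degree
  extends to a graded isomorphism.

  For (3), the polynomials \<open>t^i (1 + t)^(p - i)\<close> with \<open>d \<le> i \<le> p\<close> span those with exponents
  between \<open>d\<close> and \<open>p\<close> over the integers. The resulting \<open>b_i\<close> is the coefficient of \<open>t^i\<close> in
  \<open>(1 - t)^p H_I(t)\<close>, whence uniqueness; a decomposition of depth at least \<open>p\<close> shows that all
  coefficients of that series are nonnegative.
\<close>

unbundle fps_syntax

subsection \<open>Dimensions\<close>

text \<open>The \<open>q t\<close> form a basis whose dual coordinates are \<open>coord\<close>:
  applying \<open>coord\<close> to a relation gives independence, and every \<open>x\<close> in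
  \<open>W\<close> has the same coordinates as its expansion. Linearity of \<open>coord\<close> is
  required on \<open>W\<close> only, because graded isomorphisms are linear only on the set they
  start from.\<close>

lemma (in vector_space) dim_eq_card_coordinates:
  fixes coord :: "'b \<Rightarrow> 'c \<Rightarrow> 'a" and q :: "'c \<Rightarrow> 'b"
  assumes W: "subspace W" and P: "finite P"
    and qW: "\<And>t. t \<in> P \<Longrightarrow> q t \<in> W"
    and coord_q: "\<And>t t'. t \<in> P \<Longrightarrow> t' \<in> P \<Longrightarrow> coord (q t) t' = (if t = t' then 1 else 0)"
    and coord_add: "\<And>x y t. x \<in> W \<Longrightarrow> y \<in> W \<Longrightarrow> t \<in> P \<Longrightarrow> coord (x + y) t = coord x t + coord y t"
    and coord_scale: "\<And>c x t. x \<in> W \<Longrightarrow> t \<in> P \<Longrightarrow> coord (c *s x) t = c * coord x t"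
    and coord_eq: "\<And>x y. x \<in> W \<Longrightarrow> y \<in> W \<Longrightarrow> (\<And>t. t \<in> P \<Longrightarrow> coord x t = coord y t) \<Longrightarrow> x = y"
  shows "dim W = card P"
proof -
  have coord_0: "coord 0 t = 0" if "t \<in> P" for t
    using coord_scale[of 0 t 0] that subspace_0[OF W] by simp
  have sum_W: "(\<Sum>t\<in>T. c t *s q t) \<in> W" if "T \<subseteq> P" for T c
    using that by (intro subspace_sum[OF W] subspace_scale[OF W] qW) auto
  have coord_sum: "coord (\<Sum>t\<in>P. c t *s q t) t' = c t'" if t': "t' \<in> P" for c t'
  proof -
    \<comment> \<open>The induction passes through subsets of \<open>P\<close>, so that each partial
      sum is known to lie in \<open>W\<close>, where \<open>coord\<close> is additive.\<close>
    have "coord (\<Sum>t\<in>T. c t *s q t) t' = (\<Sum>t\<in>T. c t * (if t = t' then 1 else 0))"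
      if "T \<subseteq> P" for T
    proof -
      from finite_subset[OF that P] that show ?thesis
      proof (induction T rule: finite_induct)
        case empty
        then show ?case using coord_0 t' by simp
      next
        case (insert x F)
        then show ?case
          using coord_add[of "c x *s q x" "\<Sum>t\<in>F. c t *s q t" t'] coord_scale[of "q x" t' "c x"]
            coord_q[of x t'] t' subspace_scale[OF W, of "q x" "c x"] qW[of x] sum_W[of F c]
          by simp
      qed
    qed
    from this[OF order_refl] have "coord (\<Sum>t\<in>P. c t *s q t) t' = (\<Sum>t\<in>P. if t = t' then c t else 0)"
      by (simp add: if_distrib[of "\<lambda>x. _ * x"] cong: if_cong)
    then show ?thesis using P t' by simp
  qed
  have inj: "inj_on q P"
    using coord_q by (intro inj_onI) (metis zero_neq_one)
  have "independent (q ` P)"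
    unfolding dependent_finite[OF finite_imageI[OF P]]
  proof (clarsimp simp: sum.reindex[OF inj])
    fix c t
    assume t: "t \<in> P" and "c (q t) \<noteq> 0" and eq: "(\<Sum>t\<in>P. c (q t) *s q t) = 0"
    then show False
      using coord_sum[OF t, of "\<lambda>t. c (q t)"] coord_0[OF t] by simp
  qed
  moreover have "W \<subseteq> span (q ` P)"
  proof
    fix x assume x: "x \<in> W"
    have "x = (\<Sum>t\<in>P. coord x t *s q t)"
      using x sum_W[of P "coord x"] coord_sum[of _ "coord x"] by (intro coord_eq) auto
    also have "\<dots> \<in> span (q ` P)"
      by (intro span_sum span_scale span_base) auto
    finally show "x \<in> span (q ` P)" .
  qed
  ultimately have "dim W = card (q ` P)"
    using qW by (intro basis_card_eq_dim[symmetric]) auto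
  then show ?thesis
    using card_image[OF inj] by simp
qed

section \<open>Spaces spanned by monomials\<close>

interpretation mp: vector_space "scale :: 'k::field \<Rightarrow> ('x, 'k) mpoly \<Rightarrow> _"
  by (rule vector_space_mpoly)

text \<open>The \<open>K\<close>-span of the monomials in \<open>M\<close>, given by supports so
  that membership becomes a vanishing condition on coefficients.\<close>

definition mon_space :: "'x mon set \<Rightarrow> ('x, 'k::field) mpoly set" where
  "mon_space M = {p. Poly_Mapping.keys p \<subseteq> M}"

lemma lookup_scale: "Poly_Mapping.lookup (scale c p) w = c * Poly_Mapping.lookup p w"
proof -
  have "scale c p = Poly_Mapping.map ((*) c) p"
    by (simp add: scale_def mult_map_scale_conv_mult)
  then show ?thesis by (simp add: map.rep_eq when_def)
qed

lemma lookup_monomial: "Poly_Mapping.lookup (monomial w) v = (if w = v then 1 else 0)"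
  by (simp add: monomial_def lookup_single when_def)

lemma mon_space_iff: "p \<in> mon_space M \<longleftrightarrow> (\<forall>w. w \<notin> M \<longrightarrow> Poly_Mapping.lookup p w = 0)"
  by (auto simp: mon_space_def in_keys_iff)

lemma monomial_mem_mon_space [simp]: "monomial w \<in> mon_space M \<longleftrightarrow> w \<in> M"
  by (auto simp: mon_space_iff lookup_monomial)

lemma subspace_mon_space: "mp.subspace (mon_space M)"
  by (auto simp: mp.subspace_def mon_space_iff lookup_add lookup_scale)

lemma mon_space_homogeneous:
  "mon_space M \<inter> homogeneous k = mon_space {w \<in> M. deg w = k}"
  by (auto simp: mon_space_def homogeneous_def)

lemma dim_mon_space:
  assumes "finite M"
  shows "mp.dim (mon_space M :: ('x, 'k::field) mpoly set) = card M"
proof (rule mp.dim_eq_card_coordinates[where coord = Poly_Mapping.lookup and q = monomial])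
  show "x = y"
    if "x \<in> mon_space M" "y \<in> mon_space M"
      "\<And>t. t \<in> M \<Longrightarrow> Poly_Mapping.lookup x t = Poly_Mapping.lookup y t"
    for x y :: "('x, 'k) mpoly"
    using that by (intro poly_mapping_eqI) (metis mon_space_iff)
qed (use assms in \<open>auto simp: subspace_mon_space lookup_monomial lookup_add lookup_scale\<close>)

subsection \<open>Counting monomials\<close>

lemma deg_add: "deg (v + w) = deg v + deg w"
  by (simp add: deg_def lookup_add sum.distrib)

lemma deg_single [simp]: "deg (Poly_Mapping.single x m) = m"
  by (simp add: deg_def lookup_single when_def)

lemma lookup_le_deg: "Poly_Mapping.lookup w x \<le> deg w"
  unfolding deg_def by (rule member_le_sum) auto

lemma deg_0 [simp]: "deg 0 = 0"
  by (simp add: deg_def)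

lemma deg_eq_0_iff [simp]: "deg w = 0 \<longleftrightarrow> w = 0"
  by (auto simp: deg_def poly_mapping_eq_iff fun_eq_iff)

lemma finite_deg_eq: "finite {w :: 'x::finite mon. deg w = k}"
proof (rule finite_imageD)
  have "Poly_Mapping.lookup ` {w :: 'x mon. deg w = k} \<subseteq> (\<Pi>\<^sub>E x\<in>UNIV. {..k})"
    using lookup_le_deg by fastforce
  then show "finite (Poly_Mapping.lookup ` {w :: 'x mon. deg w = k})"
    by (rule finite_subset) (intro finite_PiE; simp)
  show "inj_on Poly_Mapping.lookup {w :: 'x mon. deg w = k}"
    by (simp add: inj_on_def lookup_inject)
qed

lemma finite_deg_eq' [simp]: "finite {w :: 'x::finite mon. P w \<and> deg w + s = k}"
  by (rule finite_subset[OF _ finite_deg_eq[of "k - s"]]) auto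

lemma finite_deg_eq'' [simp]: "finite {w :: 'x::finite mon. P w \<and> deg w = k}"
  using finite_deg_eq'[of P 0 k] by simp

lemma keys_add_nat:
  "Poly_Mapping.keys (v + w) = Poly_Mapping.keys v \<union> Poly_Mapping.keys (w :: 'x mon)"
  by (auto simp: in_keys_iff lookup_add)

text \<open>Subtraction of exponents is truncated, so \<open>w - g\<close> is the true cofactor only
  if \<open>g\<close> divides \<open>w\<close>.\<close>

lemma mon_minus_add:
  assumes "\<And>x. Poly_Mapping.lookup g x \<le> Poly_Mapping.lookup (w :: 'x mon) x"
  shows "g + (w - g) = w"
  using assms by (intro poly_mapping_eqI) (simp add: lookup_add lookup_minus)

section \<open>Generating functions of monomials\<close>

abbreviation geom :: "rat fps" where
  "geom \<equiv> inverse (1 - fps_X)"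

lemma one_minus_X_geom: "(1 - fps_X) * geom = 1"
  by (rule inverse_mult_eq_1') simp

lemma divide_one_minus_X_power: "g / (1 - fps_X) ^ m = g * geom ^ m"
  by (simp add: fps_divide_unit fps_inverse_power)

lemma geom_nth [simp]: "geom $ k = 1"
  by (simp add: fps_inverse_one_minus_fps_X)

text \<open>Splitting off the monomials without \<open>x\<close> gives \<open>(1 - X) G(Z \<union> {x}) = G(Z)\<close>.\<close>

lemma gf_monomials_supported:
  "Abs_fps (\<lambda>k. of_nat (card {v :: 'x::finite mon. Poly_Mapping.keys v \<subseteq> Z \<and> deg v = k}))
     = geom ^ card Z"
  (is "?G Z = _")
proof -
  have "finite Z" by simp
  then show ?thesis
  proof (induction Z rule: finite_induct)
    case empty
    have "{v :: 'x mon. Poly_Mapping.keys v \<subseteq> {} \<and> deg v = k} = (if k = 0 then {0} else {})" for k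
      by auto
    then show ?case by (intro fps_ext) simp
  next
    case (insert x Z)
    let ?S = "\<lambda>Z k. {v :: 'x mon. Poly_Mapping.keys v \<subseteq> Z \<and> deg v = k}"
    let ?e = "Poly_Mapping.single x (Suc 0)"
    have "?S (insert x Z) (Suc k) = ?S Z (Suc k) \<union> (\<lambda>v. ?e + v) ` ?S (insert x Z) k" for k
    proof (intro equalityI subsetI)
      fix v assume v: "v \<in> ?S (insert x Z) (Suc k)"
      show "v \<in> ?S Z (Suc k) \<union> (\<lambda>v. ?e + v) ` ?S (insert x Z) k"
      proof (cases "x \<in> Poly_Mapping.keys v")
        case True
        then have e: "?e + (v - ?e) = v"
          by (intro mon_minus_add) (auto simp: in_keys_iff lookup_single when_def)
        have "v - ?e \<in> ?S (insert x Z) k"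
          using v deg_add[of ?e "v - ?e"] keys_add_nat[of ?e "v - ?e"] unfolding e by auto
        then show ?thesis using e by (intro UnI2 image_eqI[of _ _ "v - ?e"]) simp_all
      qed (use v in auto)
    qed (auto simp: keys_add_nat deg_add)
    moreover have "?S Z (Suc k) \<inter> (\<lambda>v. ?e + v) ` ?S (insert x Z) k = {}" for k
      using insert.hyps by (auto simp: keys_add_nat)
    moreover have "card ((\<lambda>v. ?e + v) ` ?S (insert x Z) k) = card (?S (insert x Z) k)" for k
      by (rule card_image) (auto simp: inj_on_def)
    ultimately have step: "card (?S (insert x Z) (Suc k)) = card (?S Z (Suc k)) + card (?S (insert x Z) k)" for k
      by (simp add: card_Un_disjoint)
    \<comment> \<open>The recursion \<open>step\<close> covers positive degrees only; in degree 0
      both sets contain just the monomial 1.\<close>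
    have zero: "?S (insert x Z) 0 = ?S Z 0" by auto
    have "(1 - fps_X) * ?G (insert x Z) = ?G Z"
    proof (rule fps_ext)
      fix k
      show "((1 - fps_X) * ?G (insert x Z)) $ k = ?G Z $ k"
      proof (cases k)
        case 0
        then show ?thesis using zero by (simp add: left_diff_distrib del: deg_eq_0_iff)
      next
        case (Suc k')
        then show ?thesis using step[of k'] by (simp add: left_diff_distrib)
      qed
    qed
    moreover have "?G (insert x Z) = geom * ((1 - fps_X) * ?G (insert x Z))"
      by (simp only: mult.assoc[symmetric] mult.commute[of geom] one_minus_X_geom mult_1_left)
    ultimately have "?G (insert x Z) = geom * ?G Z" by (simp only:)
    then show ?case using insert by simp
  qed
qed

text \<open>Shifting by \<open>s\<close> multiplies the series by t^s. Writing
  \<open>deg v + s = k\<close>, as in \<open>shifted_comp\<close>, leaves nothing to count when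
  \<open>k < s\<close>.\<close>

lemma card_shifted_monomials:
  "of_nat (card {v :: 'x::finite mon. Poly_Mapping.keys v \<subseteq> Z \<and> deg v + s = k})
     = (fps_X ^ s * geom ^ card Z) $ k"
proof (cases "k < s")
  case True
  then have "{v :: 'x mon. Poly_Mapping.keys v \<subseteq> Z \<and> deg v + s = k} = {}" by auto
  then show ?thesis using True by (simp add: fps_X_power_mult_nth)
next
  case False
  then have "{v :: 'x mon. Poly_Mapping.keys v \<subseteq> Z \<and> deg v + s = k}
      = {v. Poly_Mapping.keys v \<subseteq> Z \<and> deg v = k - s}" by auto
  then show ?thesis using False gf_monomials_supported[of Z, THEN arg_cong, of "\<lambda>f. f $ (k - s)"]
    by (simp add: fps_X_power_mult_nth)
qed

subsection \<open>Hilbert decompositions\<close>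

text \<open>Indexes the monomial basis of \<open>direct_sum D\<close>: the pair
  \<open>(i, v)\<close> stands for the monomial \<open>v\<close> in the summand at position
  \<open>i\<close>.\<close>

definition decomp_mons :: "'x::finite decomp \<Rightarrow> (nat \<times> 'x mon) set" where
  "decomp_mons D = {(i, v). i < length D \<and> Poly_Mapping.keys v \<subseteq> fst (D ! i)}"

definition decomp_deg :: "'x::finite decomp \<Rightarrow> nat \<times> 'x mon \<Rightarrow> nat" where
  "decomp_deg D t = deg (snd t) + snd (D ! fst t)"

text \<open>The Hilbert series of the graded space encoded by \<open>D\<close>, as
  \<open>card_decomp_mons\<close> confirms.\<close>

definition decomp_series :: "'x::finite decomp \<Rightarrow> rat fps" where
  "decomp_series D = (\<Sum>i<length D. fps_X ^ snd (D ! i) * geom ^ card (fst (D ! i)))"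

lemma decomp_mons_deg_eq:
  "{t \<in> decomp_mons D. decomp_deg D t = k} =
     (SIGMA i:{..<length D}. {v. Poly_Mapping.keys v \<subseteq> fst (D ! i) \<and> deg v + snd (D ! i) = k})"
  by (auto simp: decomp_mons_def decomp_deg_def)

lemma finite_decomp_mons_deg: "finite {t \<in> decomp_mons D. decomp_deg D t = k}"
  unfolding decomp_mons_deg_eq by auto

lemma card_decomp_mons:
  "of_nat (card {t \<in> decomp_mons D. decomp_deg D t = k}) = decomp_series D $ k"
  unfolding decomp_mons_deg_eq
  by (simp add: decomp_series_def fps_sum_nth card_shifted_monomials)

lemma mem_subpolys_iff:
  "p \<in> subpolys Z \<longleftrightarrow> (\<forall>v. \<not> Poly_Mapping.keys v \<subseteq> Z \<longrightarrow> Poly_Mapping.lookup p v = 0)"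
  by (auto simp: subpolys_def in_keys_iff[of _ p])

lemma mem_direct_sum_iff:
  "h \<in> direct_sum D \<longleftrightarrow> h \<in> extensional {..<length D} \<and>
     (\<forall>i<length D. \<forall>v. (i, v) \<notin> decomp_mons D \<longrightarrow> Poly_Mapping.lookup (h i) v = 0)"
  by (auto simp: direct_sum_def mem_subpolys_iff PiE_def Pi_def decomp_mons_def)

lemma mem_direct_sum_comp_iff:
  "h \<in> direct_sum_comp D k \<longleftrightarrow> h \<in> direct_sum D \<and>
     (\<forall>i<length D. \<forall>v. Poly_Mapping.lookup (h i) v \<noteq> 0 \<longrightarrow> decomp_deg D (i, v) = k)"
  by (auto simp: direct_sum_def direct_sum_comp_def shifted_comp_def PiE_def Pi_def
      decomp_deg_def in_keys_iff)

text \<open>Coefficients outside \<open>decomp_mons D\<close> vanish, and extensionality fixes the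
  families beyond the length of \<open>D\<close>.\<close>

lemma direct_sum_eqI:
  assumes "h \<in> direct_sum D" "h' \<in> direct_sum D"
    and "\<And>i v. (i, v) \<in> decomp_mons D \<Longrightarrow> Poly_Mapping.lookup (h i) v = Poly_Mapping.lookup (h' i) v"
  shows "h = h'"
proof (rule extensionalityI)
  show "h \<in> extensional {..<length D}" "h' \<in> extensional {..<length D}"
    using assms(1,2) by (auto simp: mem_direct_sum_iff)
  show "h i = h' i" if "i \<in> {..<length D}" for i
  proof (rule poly_mapping_eqI)
    show "Poly_Mapping.lookup (h i) v = Poly_Mapping.lookup (h' i) v" for v
      using assms that by (cases "(i, v) \<in> decomp_mons D") (auto simp: mem_direct_sum_iff)
  qed
qed

text \<open>The basis monomials of the direct sum in degree \<open>k\<close>, pulled back along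
  \<open>\<phi>\<close>, form a basis of the degree \<open>k\<close> part of \<open>I\<close>; its
  coordinates are the coefficients of the components of \<open>\<phi> p\<close>.\<close>

lemma dim_graded_iso:
  fixes I :: "('x::finite, 'k::field) mpoly set"
  assumes iso: "graded_iso \<phi> I D" and W: "mp.subspace (I \<inter> homogeneous k)"
  shows "mp.dim (I \<inter> homogeneous k) = card {t \<in> decomp_mons D. decomp_deg D t = k}"
    (is "mp.dim ?W = card ?P")
proof -
  have inj: "inj_on \<phi> I" and im: "\<phi> ` ?W = direct_sum_comp D k"
    and add: "\<And>p q i. p \<in> I \<Longrightarrow> q \<in> I \<Longrightarrow> i < length D \<Longrightarrow> \<phi> (p + q) i = \<phi> p i + \<phi> q i"
    and scale: "\<And>c p i. p \<in> I \<Longrightarrow> i < length D \<Longrightarrow> \<phi> (scale c p) i = scale c (\<phi> p i)"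
    using iso unfolding graded_iso_def bij_betw_def by blast+
  \<comment> \<open>The basis family of \<open>t\<close>: its monomial at position
    \<open>fst t\<close>, zero at the other positions of the list.\<close>
  define e :: "nat \<times> 'x mon \<Rightarrow> nat \<Rightarrow> ('x, 'k) mpoly" where
    "e t = (\<lambda>i\<in>{..<length D}. if fst t = i then monomial (snd t) else 0)" for t
  have "\<exists>p\<in>?W. \<phi> p = e t" if "t \<in> ?P" for t
  proof -
    have "e t \<in> direct_sum_comp D k"
      using that by (auto simp: mem_direct_sum_comp_iff mem_direct_sum_iff e_def lookup_monomial)
    then have "e t \<in> \<phi> ` ?W" by (simp only: im)
    then show ?thesis by (elim imageE) auto
  qed
  then have "\<forall>t\<in>?P. \<exists>p. p \<in> ?W \<and> \<phi> p = e t" by blast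
  from bchoice[OF this] obtain q where q: "\<And>t. t \<in> ?P \<Longrightarrow> q t \<in> ?W \<and> \<phi> (q t) = e t" by blast
  show ?thesis
  proof (rule mp.dim_eq_card_coordinates[OF W finite_decomp_mons_deg,
        where q = q and coord = "\<lambda>p t. Poly_Mapping.lookup (\<phi> p (fst t)) (snd t)"])
    show "q t \<in> ?W" if "t \<in> ?P" for t using q that by blast
    show "Poly_Mapping.lookup (\<phi> (q t) (fst t')) (snd t') = (if t = t' then 1 else 0)"
      if "t \<in> ?P" "t' \<in> ?P" for t t'
    proof -
      have "fst t' < length D" using that(2) by (auto simp: decomp_mons_def)
      then show ?thesis
        by (simp add: conjunct2[OF q[OF that(1)]] e_def lookup_monomial prod_eq_iff)
    qed
    show "Poly_Mapping.lookup (\<phi> (x + y) (fst t)) (snd t)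
        = Poly_Mapping.lookup (\<phi> x (fst t)) (snd t) + Poly_Mapping.lookup (\<phi> y (fst t)) (snd t)"
      if "x \<in> ?W" "y \<in> ?W" "t \<in> ?P" for x y t
    proof -
      have "fst t < length D" using that(3) by (auto simp: decomp_mons_def)
      then show ?thesis using add[of x y "fst t"] that(1,2) by (simp add: lookup_add)
    qed
    show "Poly_Mapping.lookup (\<phi> (scale c x) (fst t)) (snd t)
        = c * Poly_Mapping.lookup (\<phi> x (fst t)) (snd t)"
      if "x \<in> ?W" "t \<in> ?P" for c x t
    proof -
      have "fst t < length D" using that(2) by (auto simp: decomp_mons_def)
      then show ?thesis using scale[of x "fst t" c] that(1) by (simp add: lookup_scale)
    qed
    fix x y assume x: "x \<in> ?W" and y: "y \<in> ?W"
      and eq: "\<And>t. t \<in> ?P \<Longrightarrow>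
        Poly_Mapping.lookup (\<phi> x (fst t)) (snd t) = Poly_Mapping.lookup (\<phi> y (fst t)) (snd t)"
    have mem: "\<phi> x \<in> direct_sum_comp D k" "\<phi> y \<in> direct_sum_comp D k"
      using imageI[OF x, of \<phi>] imageI[OF y, of \<phi>] by (simp_all only: im)
    have "\<phi> x = \<phi> y"
    proof (rule direct_sum_eqI)
      show "\<phi> x \<in> direct_sum D" "\<phi> y \<in> direct_sum D"
        using mem by (auto simp: mem_direct_sum_comp_iff)
      fix i v assume iv: "(i, v) \<in> decomp_mons D"
      show "Poly_Mapping.lookup (\<phi> x i) v = Poly_Mapping.lookup (\<phi> y i) v"
      \<comment> \<open>The hypothesis \<open>eq\<close> compares coefficients in degree
        \<open>k\<close> only; in other degrees both vanish, as the images lie in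
        \<open>direct_sum_comp D k\<close>.\<close>
      proof (cases "decomp_deg D (i, v) = k")
        case True
        then show ?thesis using eq[of "(i, v)"] iv by simp
      next
        case False
        moreover have "i < length D" using iv by (simp add: decomp_mons_def)
        ultimately have "Poly_Mapping.lookup (\<phi> x i) v = 0" "Poly_Mapping.lookup (\<phi> y i) v = 0"
          using mem unfolding mem_direct_sum_comp_iff by blast+
        then show ?thesis by simp
      qed
    qed
    then show "x = y" by (rule inj_onD[OF inj]) (use x y in auto)
  qed
qed

text \<open>A degree-preserving bijection of monomial bases extends linearly: the coefficient of
  \<open>v\<close> in component \<open>i\<close> of \<open>\<phi> p\<close> is that of
  \<open>\<tau> (i, v)\<close> in \<open>p\<close>.\<close>

lemma graded_isoI:
  fixes M :: "'x::finite mon set"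
  assumes bij: "bij_betw \<tau> (decomp_mons D) M"
    and degs: "\<And>t. t \<in> decomp_mons D \<Longrightarrow> deg (\<tau> t) = decomp_deg D t"
  obtains \<phi> where "graded_iso \<phi> (mon_space M :: ('x, 'k::field) mpoly set) D"
proof -
  let ?Q = "decomp_mons D" and ?I = "mon_space M :: ('x, 'k) mpoly set"
  let ?lk = Poly_Mapping.lookup
  have \<tau>: "\<tau> t \<in> M" if "t \<in> ?Q" for t using bij that by (auto simp: bij_betw_def)
  have inj: "inj_on \<tau> ?Q" using bij by (simp add: bij_betw_def)
  have surj: "\<exists>t\<in>?Q. w = \<tau> t" if "w \<in> M" for w using bij that by (auto simp: bij_betw_def)
  define \<phi> :: "('x, 'k) mpoly \<Rightarrow> nat \<Rightarrow> ('x, 'k) mpoly" where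
    "\<phi> p = (\<lambda>i\<in>{..<length D}.
       Poly_Mapping.Abs_poly_mapping (\<lambda>v. if (i, v) \<in> ?Q then ?lk p (\<tau> (i, v)) else 0))" for p
  \<comment> \<open>\<open>Abs_poly_mapping\<close> computes as intended only for finite support,
    which follows from injectivity of \<open>\<tau>\<close> and finiteness of the support of
    \<open>p\<close>.\<close>
  have lookup_\<phi>: "?lk (\<phi> p i) v = (if (i, v) \<in> ?Q then ?lk p (\<tau> (i, v)) else 0)"
    if "i < length D" for p i v
  proof -
    have "finite ((\<lambda>v. \<tau> (i, v)) ` {v. (i, v) \<in> ?Q \<and> ?lk p (\<tau> (i, v)) \<noteq> 0})"
      by (rule finite_subset[OF _ finite_keys[of p]]) (auto simp: in_keys_iff)
    then have "finite {v. (i, v) \<in> ?Q \<and> ?lk p (\<tau> (i, v)) \<noteq> 0}"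
      by (rule finite_imageD) (use inj in \<open>auto simp: inj_on_def\<close>)
    then have "finite {v. (if (i, v) \<in> ?Q then ?lk p (\<tau> (i, v)) else 0) \<noteq> 0}"
      by (rule rev_finite_subset) (auto split: if_splits)
    then show ?thesis
      using that by (simp add: \<phi>_def lookup_Abs_poly_mapping)
  qed
  have \<phi>_mem: "\<phi> p \<in> direct_sum D" for p
    by (auto simp: mem_direct_sum_iff lookup_\<phi>) (simp add: \<phi>_def)
  have inj_\<phi>: "inj_on \<phi> ?I"
  proof (rule inj_onI)
    fix p p' assume p: "p \<in> ?I" "p' \<in> ?I" and eq: "\<phi> p = \<phi> p'"
    show "p = p'"
    proof (rule poly_mapping_eqI)
      fix w
      show "?lk p w = ?lk p' w"
      proof (cases "w \<in> M")
        case True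
        then obtain i v where "(i, v) \<in> ?Q" "w = \<tau> (i, v)" using surj by force
        then show ?thesis
          using lookup_\<phi>[of i p v] lookup_\<phi>[of i p' v] eq by (auto simp: decomp_mons_def)
      qed (use p in \<open>auto simp: mon_space_iff\<close>)
    qed
  qed
  have ex_\<phi>: "\<exists>p\<in>?I. \<phi> p = h" if h: "h \<in> direct_sum D" for h
  proof -
    define \<rho> where "\<rho> = inv_into ?Q \<tau>"
    have \<rho>: "\<rho> w \<in> ?Q" "\<tau> (\<rho> w) = w" if "w \<in> M" for w
      using surj[OF that] unfolding \<rho>_def by (auto intro: inv_into_into f_inv_into_f)
    have \<rho>_\<tau>: "\<rho> (\<tau> t) = t" if "t \<in> ?Q" for t
      using inj that by (simp add: \<rho>_def)
    \<comment> \<open>The coefficients of the preimage of \<open>h\<close>, transported back along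
      the inverse \<open>\<rho>\<close> of \<open>\<tau>\<close>.\<close>
    define g where "g w = (if w \<in> M then ?lk (h (fst (\<rho> w))) (snd (\<rho> w)) else 0)" for w
    have "{w. g w \<noteq> 0} \<subseteq> \<tau> ` (SIGMA i:{..<length D}. Poly_Mapping.keys (h i))"
    proof
      fix w assume "w \<in> {w. g w \<noteq> 0}"
      then have w: "w \<in> M" "?lk (h (fst (\<rho> w))) (snd (\<rho> w)) \<noteq> 0"
        by (auto simp: g_def split: if_splits)
      show "w \<in> \<tau> ` (SIGMA i:{..<length D}. Poly_Mapping.keys (h i))"
        using w \<rho>[of w]
        by (intro image_eqI[of _ _ "\<rho> w"]) (auto simp: decomp_mons_def in_keys_iff mem_Sigma_iff split: prod.splits)
    qed
    then have "finite {w. g w \<noteq> 0}" by (rule finite_subset) auto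
    then have lk: "?lk (Poly_Mapping.Abs_poly_mapping g) w = g w" for w
      by (simp add: lookup_Abs_poly_mapping)
    show ?thesis
    proof (intro bexI)
      show "Poly_Mapping.Abs_poly_mapping g \<in> ?I"
        by (auto simp: mon_space_iff lk g_def)
      show "\<phi> (Poly_Mapping.Abs_poly_mapping g) = h"
      proof (rule direct_sum_eqI[OF \<phi>_mem h])
        fix i v assume iv: "(i, v) \<in> ?Q"
        then have "i < length D" by (simp add: decomp_mons_def)
        then show "?lk (\<phi> (Poly_Mapping.Abs_poly_mapping g) i) v = ?lk (h i) v"
          using iv \<tau>[OF iv] by (simp add: lookup_\<phi> lk g_def \<rho>_\<tau>)
      qed
    qed
  qed
  have im: "\<phi> ` (?I \<inter> homogeneous k) = direct_sum_comp D k" for k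
  proof (intro equalityI subsetI)
    fix h :: "nat \<Rightarrow> ('x, 'k) mpoly" assume "h \<in> \<phi> ` (?I \<inter> homogeneous k)"
    then obtain p where p: "p \<in> homogeneous k" "h = \<phi> p" by auto
    have "decomp_deg D (i, v) = k" if i: "i < length D" and nz: "?lk (\<phi> p i) v \<noteq> 0" for i v
    proof -
      have iv: "(i, v) \<in> ?Q" and "?lk p (\<tau> (i, v)) \<noteq> 0"
        using nz by (simp_all add: lookup_\<phi>[OF i] split: if_splits)
      then have "deg (\<tau> (i, v)) = k"
        using p(1) unfolding homogeneous_def by (simp add: in_keys_iff)
      then show ?thesis by (simp add: degs[OF iv])
    qed
    then show "h \<in> direct_sum_comp D k"
      using p(2) \<phi>_mem by (auto simp: mem_direct_sum_comp_iff)
  next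
    fix h :: "nat \<Rightarrow> ('x, 'k) mpoly" assume h: "h \<in> direct_sum_comp D k"
    then obtain p where p: "p \<in> ?I" "\<phi> p = h"
      using ex_\<phi>[of h] unfolding mem_direct_sum_comp_iff by blast
    have "deg w = k" if w: "?lk p w \<noteq> 0" for w
    proof -
      have "w \<in> M" using p(1) w by (auto simp: mon_space_iff)
      then obtain i v where iv: "(i, v) \<in> ?Q" "w = \<tau> (i, v)" using surj by force
      then have i: "i < length D" by (simp add: decomp_mons_def)
      with iv w have "?lk (h i) v \<noteq> 0" using p(2) lookup_\<phi>[of i p v] by auto
      with h i have "decomp_deg D (i, v) = k" unfolding mem_direct_sum_comp_iff by blast
      then show ?thesis using degs[OF iv(1)] iv(2) by simp
    qed
    then have "p \<in> homogeneous k" by (simp add: homogeneous_def in_keys_iff)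
    with p show "h \<in> \<phi> ` (?I \<inter> homogeneous k)" by blast
  qed
  have "graded_iso \<phi> ?I D"
    unfolding graded_iso_def
  proof (intro conjI ballI allI impI)
    show "bij_betw \<phi> ?I (direct_sum D)"
      using inj_\<phi> \<phi>_mem ex_\<phi> by (auto simp: bij_betw_def)
    show "\<phi> (p + q) i = \<phi> p i + \<phi> q i" if "i < length D" for p q i
      using that by (intro poly_mapping_eqI) (simp add: lookup_\<phi> lookup_add)
    show "\<phi> (scale c p) i = scale c (\<phi> p i)" if "i < length D" for c p i
      using that by (intro poly_mapping_eqI) (simp add: lookup_\<phi> lookup_scale)
  qed (rule im)
  then show ?thesis by (rule that)
qed

section \<open>Hilbert decompositions as identities of series\<close>

lemma hilbert_series_mon_space:
  "hilbert_series (mon_space M :: ('x::finite, 'k::field) mpoly set) $ k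
     = of_nat (card {w \<in> M. deg w = k})"
  by (simp add: hilbert_series_def mon_space_homogeneous dim_mon_space)

text \<open>Forwards, an isomorphism preserves the dimension in each degree. Backwards, equal
  coefficients are equal finite cardinalities, which give a bijection of basis monomials in each
  degree; these glue to one that extends linearly.\<close>

lemma hilbert_decomp_mon_space_iff:
  fixes M :: "'x::finite mon set"
  shows "hilbert_decomp (mon_space M :: ('x, 'k::field) mpoly set) D \<longleftrightarrow>
    hilbert_series (mon_space M :: ('x, 'k) mpoly set) = decomp_series D"
    (is "hilbert_decomp ?I D \<longleftrightarrow> _")
proof
  assume "hilbert_decomp ?I D"
  then obtain \<phi> where \<phi>: "graded_iso \<phi> ?I D" by (auto simp: hilbert_decomp_def)
  show "hilbert_series ?I = decomp_series D"
  proof (rule fps_ext)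
    fix k
    have "mp.subspace (?I \<inter> homogeneous k)"
      by (simp add: mon_space_homogeneous subspace_mon_space)
    from dim_graded_iso[OF \<phi> this] show "hilbert_series ?I $ k = decomp_series D $ k"
      by (simp add: hilbert_series_def flip: card_decomp_mons)
  qed
next
  assume eq: "hilbert_series ?I = decomp_series D"
  have "\<exists>\<sigma>. bij_betw \<sigma> {t \<in> decomp_mons D. decomp_deg D t = k} {w \<in> M. deg w = k}" for k
  proof -
    have "(of_nat (card {w \<in> M. deg w = k}) :: rat)
        = of_nat (card {t \<in> decomp_mons D. decomp_deg D t = k})"
      unfolding card_decomp_mons hilbert_series_mon_space[symmetric, where 'k = 'k] eq ..
    then show ?thesis
      by (intro finite_same_card_bij finite_decomp_mons_deg) simp_all
  qed
  then obtain \<sigma> where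
    \<sigma>: "\<And>k. bij_betw (\<sigma> k) {t \<in> decomp_mons D. decomp_deg D t = k} {w \<in> M. deg w = k}"
    using choice[of "\<lambda>k \<sigma>. bij_betw \<sigma> {t \<in> decomp_mons D. decomp_deg D t = k} {w \<in> M. deg w = k}"]
    by blast
  \<comment> \<open>Gluing stays injective because \<open>\<sigma> k\<close> takes values of degree
    \<open>k\<close>, so different degrees cannot collide.\<close>
  define \<tau> where "\<tau> t = \<sigma> (decomp_deg D t) t" for t
  have \<tau>: "\<tau> t \<in> M \<and> deg (\<tau> t) = decomp_deg D t" if "t \<in> decomp_mons D" for t
    using bij_betw_apply[OF \<sigma>[of "decomp_deg D t"], of t] that by (simp add: \<tau>_def)
  have "bij_betw \<tau> (decomp_mons D) M"
    unfolding bij_betw_def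
  proof (intro conjI equalityI subsetI)
    show "inj_on \<tau> (decomp_mons D)"
    proof (rule inj_onI)
      fix t t' assume t: "t \<in> decomp_mons D" "t' \<in> decomp_mons D" "\<tau> t = \<tau> t'"
      then have "decomp_deg D t = decomp_deg D t'" using \<tau>[of t] \<tau>[of t'] by simp
      then show "t = t'"
        using t by (intro inj_onD[OF bij_betw_imp_inj_on[OF \<sigma>[of "decomp_deg D t"]]]) (simp_all add: \<tau>_def)
    qed
    show "w \<in> M" if "w \<in> \<tau> ` decomp_mons D" for w using that \<tau> by blast
    fix w assume "w \<in> M"
    then have "w \<in> \<sigma> (deg w) ` {t \<in> decomp_mons D. decomp_deg D t = deg w}"
      using \<sigma>[of "deg w"] by (simp add: bij_betw_def)
    then obtain t where t: "w = \<sigma> (deg w) t" "t \<in> {t \<in> decomp_mons D. decomp_deg D t = deg w}"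
      by (rule imageE)
    show "w \<in> \<tau> ` decomp_mons D"
    proof (rule image_eqI)
      show "w = \<tau> t" unfolding \<tau>_def using t by (metis (mono_tags, lifting) mem_Collect_eq)
      show "t \<in> decomp_mons D" using t(2) by simp
    qed
  qed
  then obtain \<phi> where "graded_iso \<phi> ?I D"
    by (rule graded_isoI) (use \<tau> in blast)
  then show "hilbert_decomp ?I D" by (auto simp: hilbert_decomp_def)
qed

subsection \<open>Monomial ideals\<close>

text \<open>These are exactly the exponent vectors of the monomials in the ideal generated by
  \<open>G\<close>.\<close>

definition mon_multiples :: "'x mon set \<Rightarrow> 'x mon set" where
  "mon_multiples G = {w. \<exists>g\<in>G. \<forall>x. Poly_Mapping.lookup g x \<le> Poly_Mapping.lookup w x}"

lemma mon_multiples_add: "w \<in> mon_multiples G \<Longrightarrow> v + w \<in> mon_multiples G"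
  by (auto simp: mon_multiples_def lookup_add intro: trans_le_add2)

text \<open>Multiples of \<open>G\<close> are closed under adding exponents, so the right-hand side
  is an ideal containing the generators. Conversely, each term of a polynomial supported there is a
  multiple of a generator.\<close>

lemma mon_ideal_eq_mon_space:
  "(mon_ideal G :: ('x, 'k::field) mpoly set) = mon_space (mon_multiples G)"
proof
  have "module.subspace (*) (mon_space (mon_multiples G) :: ('x, 'k) mpoly set)"
    unfolding module.subspace_def[OF module_mpoly]
  proof (intro conjI allI ballI)
    show "0 \<in> (mon_space (mon_multiples G) :: ('x, 'k) mpoly set)"
      by (simp add: mon_space_iff)
    show "p + q \<in> mon_space (mon_multiples G)"
      if "p \<in> mon_space (mon_multiples G)" "q \<in> mon_space (mon_multiples G)" for p q :: "('x, 'k) mpoly"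
      using that by (simp add: mon_space_iff lookup_add)
    show "c * p \<in> mon_space (mon_multiples G)"
      if "p \<in> mon_space (mon_multiples G)" for c p :: "('x, 'k) mpoly"
      using that keys_mult[of c p] mon_multiples_add[of _ G] unfolding mon_space_def by blast
  qed
  then show "mon_ideal G \<subseteq> (mon_space (mon_multiples G) :: ('x, 'k) mpoly set)"
    unfolding mon_ideal_def
    by (rule module.span_minimal[OF module_mpoly, rotated]) (auto simp: mon_multiples_def)
next
  show "mon_space (mon_multiples G) \<subseteq> (mon_ideal G :: ('x, 'k) mpoly set)"
  proof
    fix p :: "('x, 'k) mpoly"
    assume p: "p \<in> mon_space (mon_multiples G)"
    have "p = (\<Sum>w\<in>Poly_Mapping.keys p. Poly_Mapping.single w (Poly_Mapping.lookup p w))"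
      by (rule poly_mapping_eqI) (simp add: lookup_sum lookup_single when_def in_keys_iff)
    also have "\<dots> \<in> mon_ideal G"
      unfolding mon_ideal_def
    proof (rule module.span_sum[OF module_mpoly])
      fix w assume "w \<in> Poly_Mapping.keys p"
      then have "w \<in> mon_multiples G" using p by (auto simp: mon_space_def)
      then obtain g where g: "g \<in> G" "g + (w - g) = w"
        using mon_minus_add unfolding mon_multiples_def by blast
      have "Poly_Mapping.single w (Poly_Mapping.lookup p w)
          = Poly_Mapping.single (w - g) (Poly_Mapping.lookup p w) * monomial g"
        using g(2) by (simp add: monomial_def mult_single add.commute)
      also have "\<dots> \<in> module.span (*) (monomial ` G)"
        using g(1)
        by (intro module.span_scale[OF module_mpoly] module.span_base[OF module_mpoly]) simp
      finally show "Poly_Mapping.single w (Poly_Mapping.lookup p w) \<in> module.span (*) (monomial ` G)" .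
    qed
    finally show "p \<in> mon_ideal G" .
  qed
qed

lemma monomial_mem_mon_ideal [simp]:
  "(monomial w :: ('x, 'k::field) mpoly) \<in> mon_ideal G \<longleftrightarrow> w \<in> mon_multiples G"
  by (simp add: mon_ideal_eq_mon_space)

text \<open>The ideal determines its monomials. This links a squarefree generating set to the given
  generators.\<close>

lemma mon_multiples_eqI:
  assumes "(mon_ideal G :: ('x, 'k::field) mpoly set) = mon_ideal G'"
  shows "mon_multiples G = mon_multiples G'"
  using assms by (metis monomial_mem_mon_ideal subsetI subset_antisym)

section \<open>Squarefree monomials and radicals\<close>

lemma deg_mono:
  "(\<And>x. Poly_Mapping.lookup v x \<le> Poly_Mapping.lookup w x) \<Longrightarrow> deg v \<le> deg w"
  by (simp add: deg_def sum_mono)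

lemma lookup_sqfree:
  assumes "sqfree_mon e"
  shows "Poly_Mapping.lookup e x = (if x \<in> Poly_Mapping.keys e then 1 else 0)"
  using assms[unfolded sqfree_mon_def, rule_format, of x] by (simp add: in_keys_iff)

lemma deg_sqfree: "sqfree_mon e \<Longrightarrow> deg e = card (Poly_Mapping.keys e)"
  by (simp add: deg_def lookup_sqfree sum.If_cases)

lemma sqfree_eqI:
  "sqfree_mon e \<Longrightarrow> sqfree_mon e' \<Longrightarrow> Poly_Mapping.keys e = Poly_Mapping.keys e' \<Longrightarrow> e = e'"
  by (rule poly_mapping_eqI) (simp add: lookup_sqfree)

lemma finite_sqfree: "finite {e :: 'x::finite mon. sqfree_mon e}"
proof (rule inj_on_finite)
  show "inj_on Poly_Mapping.keys {e :: 'x mon. sqfree_mon e}"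
    by (rule inj_onI) (simp add: sqfree_eqI)
  show "Poly_Mapping.keys ` {e :: 'x mon. sqfree_mon e} \<subseteq> UNIV" "finite (UNIV :: 'x set set)"
    by simp_all
qed

text \<open>The witness is the radical of \<open>w\<close>: a squarefree generator dividing
  \<open>w\<close> already divides the radical.\<close>

lemma sqfree_radical_mem:
  fixes w :: "'x::finite mon"
  assumes G: "\<forall>g\<in>G. sqfree_mon g" and w: "w \<in> mon_multiples G"
  obtains e where "sqfree_mon e" "e \<in> mon_multiples G" "Poly_Mapping.keys e = Poly_Mapping.keys w"
    "\<And>x. Poly_Mapping.lookup e x \<le> Poly_Mapping.lookup w x"
proof -
  define e where
    "e = Poly_Mapping.Abs_poly_mapping (\<lambda>x. if x \<in> Poly_Mapping.keys w then 1 else 0 :: nat)"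
  have lk: "Poly_Mapping.lookup e x = (if x \<in> Poly_Mapping.keys w then 1 else 0)" for x
    by (simp add: e_def lookup_Abs_poly_mapping)
  obtain g where g: "g \<in> G" "\<And>x. Poly_Mapping.lookup g x \<le> Poly_Mapping.lookup w x"
    using w by (auto simp: mon_multiples_def)
  have "Poly_Mapping.lookup g x \<le> Poly_Mapping.lookup e x" for x
    using g(2)[of x] G[rule_format, OF g(1), unfolded sqfree_mon_def, rule_format, of x]
    by (auto simp: lk in_keys_iff)
  then have "e \<in> mon_multiples G" using g(1) by (auto simp: mon_multiples_def)
  then show ?thesis
  proof (rule that[rotated])
    show "sqfree_mon e" by (simp add: sqfree_mon_def lk)
    show "Poly_Mapping.keys e = Poly_Mapping.keys w"
      by (auto simp: in_keys_iff[of _ e] lk split: if_splits)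
    show "Poly_Mapping.lookup e x \<le> Poly_Mapping.lookup w x" for x
      by (auto simp: lk in_keys_iff)
  qed
qed

text \<open>Each monomial \<open>w\<close> of the ideal is sorted under its radical \<open>e\<close>, so that \<open>w / e\<close> ranges over all
  monomials in the variables dividing \<open>e\<close>.\<close>

lemma hilbert_series_sqfree_monomials:
  fixes G :: "'x::finite mon set"
  assumes G: "\<forall>g\<in>G. sqfree_mon g"
  shows "hilbert_series (mon_ideal G :: ('x, 'k::field) mpoly set)
    = (\<Sum>e | sqfree_mon e \<and> e \<in> mon_multiples G. (fps_X * geom) ^ deg e)"
proof (rule fps_ext)
  fix k
  let ?E = "{e. sqfree_mon e \<and> e \<in> mon_multiples G}"
  let ?F = "\<lambda>e. {v. Poly_Mapping.keys v \<subseteq> Poly_Mapping.keys e \<and> deg v + deg e = k}"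
  have fin: "finite ?E" by (rule finite_subset[OF _ finite_sqfree]) auto
  have keys: "Poly_Mapping.keys (e + v) = Poly_Mapping.keys e" if "v \<in> ?F e" for e v :: "'x mon"
    using that by (auto simp: keys_add_nat)
  have "{w \<in> mon_multiples G. deg w = k} = (\<Union>e\<in>?E. (\<lambda>v. e + v) ` ?F e)"
  proof (intro equalityI subsetI)
    fix w assume w: "w \<in> {w \<in> mon_multiples G. deg w = k}"
    then have "w \<in> mon_multiples G" by simp
    from G this obtain e where e: "sqfree_mon e" "e \<in> mon_multiples G"
      "Poly_Mapping.keys e = Poly_Mapping.keys w"
      "\<And>x. Poly_Mapping.lookup e x \<le> Poly_Mapping.lookup w x"
      by (rule sqfree_radical_mem) (rule that)
    have eq: "e + (w - e) = w" by (rule mon_minus_add) (rule e(4))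
    have "w - e \<in> ?F e"
      using keys_add_nat[of e "w - e"] deg_add[of e "w - e"] e(3) w unfolding eq by auto
    then have "w \<in> (\<lambda>v. e + v) ` ?F e" by (intro image_eqI[of _ _ "w - e"]) (simp only: eq)
    then show "w \<in> (\<Union>e\<in>?E. (\<lambda>v. e + v) ` ?F e)" using e(1,2) by blast
  next
    fix w assume "w \<in> (\<Union>e\<in>?E. (\<lambda>v. e + v) ` ?F e)"
    then obtain e v where "e \<in> mon_multiples G" "w = e + v" "deg v + deg e = k"
      by auto
    then show "w \<in> {w \<in> mon_multiples G. deg w = k}"
      using mon_multiples_add[of e G v] by (simp add: deg_add add.commute)
  qed
  \<comment> \<open>The blocks are disjoint: \<open>e + v\<close> has the same variables as
    \<open>e\<close>, and a squarefree monomial is determined by its variables.\<close>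
  moreover have "(\<lambda>v. e + v) ` ?F e \<inter> (\<lambda>v. e' + v) ` ?F e' = {}"
    if e: "e \<in> ?E" "e' \<in> ?E" "e \<noteq> e'" for e e'
  proof (rule equals0I)
    fix w assume "w \<in> (\<lambda>v. e + v) ` ?F e \<inter> (\<lambda>v. e' + v) ` ?F e'"
    then obtain v v' where v: "w = e + v" "v \<in> ?F e" "w = e' + v'" "v' \<in> ?F e'"
      by (elim IntE imageE) (rule that)
    have "Poly_Mapping.keys e = Poly_Mapping.keys e'"
      using keys[OF v(2)] keys[OF v(4)] by (simp only: v(1)[symmetric] v(3)[symmetric])
    then show False using e sqfree_eqI[of e e'] by simp
  qed
  moreover have "card ((\<lambda>v. e + v) ` ?F e) = card (?F e)" for e :: "'x mon"
    by (rule card_image) (simp add: inj_on_def)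
  ultimately have "card {w \<in> mon_multiples G. deg w = k} = (\<Sum>e\<in>?E. card (?F e))"
    using fin by (simp add: card_UN_disjoint)
  then have "hilbert_series (mon_ideal G :: ('x, 'k) mpoly set) $ k
      = (\<Sum>e\<in>?E. of_nat (card (?F e)))"
    by (simp add: mon_ideal_eq_mon_space hilbert_series_mon_space)
  also have "\<dots> = (\<Sum>e\<in>?E. ((fps_X * geom) ^ deg e) $ k)"
    by (intro sum.cong refl) (simp add: card_shifted_monomials power_mult_distrib flip: deg_sqfree)
  finally show "hilbert_series (mon_ideal G :: ('x, 'k) mpoly set) $ k
      = (\<Sum>e\<in>?E. (fps_X * geom) ^ deg e) $ k"
    by (simp add: fps_sum_nth)
qed

text \<open>Grouping the radicals by degree yields f(t/(1 - t)); the bound \<open>d\<close> and the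
  number of variables delimit the degrees that occur.\<close>

lemma hilbert_series_sqfree:
  fixes I :: "('x::finite, 'k::field) mpoly set"
  assumes I: "I = mon_ideal G" and G: "\<forall>g\<in>G. sqfree_mon g"
    and d: "\<And>w. w \<in> mon_multiples G \<Longrightarrow> d \<le> deg w"
  shows "hilbert_series I = (\<Sum>i=d..CARD('x). of_nat (num_sqfree I i) * (fps_X * geom) ^ i)"
proof -
  let ?E = "{e :: 'x mon. sqfree_mon e \<and> e \<in> mon_multiples G}"
  have fin: "finite ?E" by (rule finite_subset[OF _ finite_sqfree]) auto
  have "hilbert_series I = (\<Sum>e\<in>?E. (fps_X * geom) ^ deg e)"
    unfolding I by (rule hilbert_series_sqfree_monomials[OF G])
  also have "\<dots> = (\<Sum>i\<in>{d..CARD('x)}. \<Sum>e | e \<in> ?E \<and> deg e = i. (fps_X * geom) ^ deg e)"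
  proof (rule sum.group[symmetric, OF fin])
    have "deg e \<le> CARD('x)" if "sqfree_mon e" for e :: "'x mon"
      unfolding deg_sqfree[OF that] by (rule card_mono) simp_all
    then show "deg ` ?E \<subseteq> {d..CARD('x)}" using d by auto
  qed simp
  also have "\<dots> = (\<Sum>i=d..CARD('x). of_nat (num_sqfree I i) * (fps_X * geom) ^ i)"
  proof (intro sum.cong refl)
    fix i
    have eq: "{w. sqfree_mon w \<and> deg w = i \<and> (monomial w :: ('x, 'k) mpoly) \<in> I}
        = {e. e \<in> ?E \<and> deg e = i}"
      by (auto simp: I)
    have "(\<Sum>e | e \<in> ?E \<and> deg e = i. (fps_X * geom) ^ deg e)
        = (\<Sum>e | e \<in> ?E \<and> deg e = i. (fps_X * geom) ^ i)"
      by (intro sum.cong) auto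
    then show "(\<Sum>e | e \<in> ?E \<and> deg e = i. (fps_X * geom) ^ deg e)
        = of_nat (num_sqfree I i) * (fps_X * geom) ^ i"
      by (simp only: sum_constant num_sqfree_def eq)
  qed
  finally show ?thesis .
qed

subsection \<open>Hilbert depth\<close>

text \<open>Makes the maximum in \<open>hdepth\<close> well behaved. The empty list has the
  unspecified depth \<open>Min {}\<close>, hence the extra element of the bounding set.\<close>

lemma finite_decomp_depths: "finite {decomp_depth (D :: 'x::finite decomp) | D. P D}"
proof (rule finite_subset)
  show "{decomp_depth (D :: 'x decomp) | D. P D} \<subseteq> insert (Min {}) {..CARD('x)}"
  proof
    fix m assume "m \<in> {decomp_depth (D :: 'x decomp) | D. P D}"
    then obtain D :: "'x decomp" where m: "m = decomp_depth D" by blast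
    have "decomp_depth D \<in> card ` fst ` set D" if "D \<noteq> []"
      unfolding decomp_depth_def using that by (intro Min_in) auto
    moreover have "m \<le> CARD('x)" if "m \<in> card ` fst ` set D" for m
      using that by (auto intro: card_mono)
    ultimately show "m \<in> insert (Min {}) {..CARD('x)}"
      unfolding m by (cases "D = []") (simp_all add: decomp_depth_def)
  qed
qed simp

lemma le_hdepthI: "hilbert_decomp I D \<Longrightarrow> p \<le> decomp_depth D \<Longrightarrow> p \<le> hdepth I"
  unfolding hdepth_def by (rule order_trans[OF _ Max_ge]) (auto intro: finite_decomp_depths)

text \<open>The decomposition \<open>D0\<close> makes the set of depths nonempty, so that its
  maximum is attained.\<close>

lemma le_hdepthE:
  assumes "p \<le> hdepth I" and "hilbert_decomp I D0"
  obtains D where "hilbert_decomp I D" "\<And>Z s. (Z, s) \<in> set D \<Longrightarrow> p \<le> card Z"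
proof -
  have "hdepth I \<in> {decomp_depth D | D. hilbert_decomp I D}"
    unfolding hdepth_def by (rule Max_in) (use assms(2) finite_decomp_depths in auto)
  then obtain D where D: "hilbert_decomp I D" "hdepth I = decomp_depth D" by auto
  show ?thesis
  proof (rule that[OF D(1)])
    fix Z s assume "(Z, s) \<in> set D"
    then have "decomp_depth D \<le> card Z"
      unfolding decomp_depth_def by (intro Min_le) force+
    then show "p \<le> card Z" using assms(1) D(2) by simp
  qed
qed

lemma decomp_series_eq_sum_list:
  "decomp_series D = sum_list (map (\<lambda>(Z, s). fps_X ^ s * geom ^ card Z) D)"
  by (simp add: decomp_series_def sum_list_sum_nth atLeast0LessThan case_prod_beta)

text \<open>The term for \<open>j\<close> is realized by \<open>b j\<close> copies of K[Z](-\<alpha>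
  j) with |Z| = \<open>\<gamma> j\<close>; such a Z exists because \<open>\<gamma> j\<close> is at
  most the number of variables. A nonzero series forces a nonempty list, so its depth is a genuine
  minimum.\<close>

lemma hilbert_decomp_of_series:
  fixes I :: "('x::finite, 'k::field) mpoly set" and J :: "'j set" and b \<alpha> \<gamma> :: "'j \<Rightarrow> nat"
  assumes I: "I = mon_space M" and J: "finite J"
    and H: "hilbert_series I = (\<Sum>j\<in>J. of_nat (b j) * (fps_X ^ \<alpha> j * geom ^ \<gamma> j))"
    and nz: "hilbert_series I \<noteq> 0"
    and \<gamma>: "\<And>j. j \<in> J \<Longrightarrow> p \<le> \<gamma> j \<and> \<gamma> j \<le> CARD('x)"
  obtains D where "hilbert_decomp I D" "p \<le> decomp_depth D"
proof -
  obtain js where js: "set js = J" "distinct js" using finite_distinct_list[OF J] by blast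
  have "\<forall>j\<in>J. \<exists>Z :: 'x set. card Z = \<gamma> j"
    using \<gamma> obtain_subset_with_card_n[of _ "UNIV :: 'x set"] by metis
  from bchoice[OF this] obtain Z :: "'j \<Rightarrow> 'x set" where Z: "\<And>j. j \<in> J \<Longrightarrow> card (Z j) = \<gamma> j" by blast
  define D where "D = concat (map (\<lambda>j. replicate (b j) (Z j, \<alpha> j)) js)"
  have "decomp_series D = (\<Sum>j\<leftarrow>js. of_nat (b j) * (fps_X ^ \<alpha> j * geom ^ card (Z j)))"
    unfolding decomp_series_eq_sum_list D_def
    by (induction js) (simp_all add: sum_list_replicate)
  also have "\<dots> = (\<Sum>j\<in>J. of_nat (b j) * (fps_X ^ \<alpha> j * geom ^ card (Z j)))"
    using js by (simp add: sum_list_distinct_conv_sum_set)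
  also have "\<dots> = hilbert_series I"
    unfolding H using Z by (intro sum.cong refl) simp
  finally have series: "decomp_series D = hilbert_series I" .
  have "hilbert_decomp I D"
    using series unfolding I hilbert_decomp_mon_space_iff by simp
  moreover have "D \<noteq> []"
    using nz series by (auto simp: decomp_series_def)
  then have "p \<le> decomp_depth D"
    unfolding decomp_depth_def using \<gamma> Z js(1) by (subst Min_ge_iff) (auto simp: D_def)
  ultimately show ?thesis by (rule that)
qed

subsection \<open>Substituting \<open>t / (1 - t)\<close>\<close>

text \<open>The ring homomorphism from integer polynomials to power series that sends t to t/(1 -
  t).\<close>

definition ev_geom :: "int poly \<Rightarrow> rat fps" where
  "ev_geom p = poly (map_poly of_int p) (fps_X * geom)"

lemma ev_geom_0 [simp]: "ev_geom 0 = 0"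
  by (simp add: ev_geom_def)

lemma ev_geom_add: "ev_geom (p + q) = ev_geom p + ev_geom q"
proof -
  have "(map_poly of_int (p + q) :: rat fps poly) = map_poly of_int p + map_poly of_int q"
    by (rule poly_eqI) (simp add: coeff_map_poly)
  then show ?thesis by (simp add: ev_geom_def)
qed

lemma ev_geom_mult: "ev_geom (p * q) = ev_geom p * ev_geom q"
proof -
  have "(map_poly of_int (p * q) :: rat fps poly) = map_poly of_int p * map_poly of_int q"
    by (rule poly_eqI) (simp add: coeff_map_poly coeff_mult)
  then show ?thesis by (simp add: ev_geom_def)
qed

lemma ev_geom_sum: "ev_geom (\<Sum>j\<in>J. p j) = (\<Sum>j\<in>J. ev_geom (p j))"
  by (induction J rule: infinite_finite_induct) (simp_all add: ev_geom_add)

lemma ev_geom_smult: "ev_geom (smult c p) = of_int c * ev_geom p"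
proof -
  have "(map_poly of_int (smult c p) :: rat fps poly) = smult (of_int c) (map_poly of_int p)"
    by (rule poly_eqI) (simp add: coeff_map_poly)
  then show ?thesis by (simp add: ev_geom_def)
qed

lemma ev_geom_monom: "ev_geom (monom c i) = of_int c * (fps_X * geom) ^ i"
  by (simp add: ev_geom_def map_poly_monom poly_monom)

lemma ev_geom_one_plus_t_power: "ev_geom ([:1, 1:] ^ m) = geom ^ m"
proof (induction m)
  case (Suc m)
  have "ev_geom [:1, 1:] = 1 + fps_X * geom" by (simp add: ev_geom_def map_poly_pCons)
  also have "\<dots> = geom" using one_minus_X_geom by (simp add: left_diff_distrib diff_eq_eq)
  finally show ?case using Suc by (simp add: ev_geom_mult del: mult_pCons_left)
qed (simp add: ev_geom_def)

lemma ev_geom_term: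
  "ev_geom (smult c (monom 1 i * [:1, 1:] ^ m)) = of_int c * (fps_X ^ i * geom ^ (i + m))"
  by (simp add: ev_geom_smult ev_geom_mult ev_geom_monom ev_geom_one_plus_t_power
      power_mult_distrib power_add mult.assoc)

section \<open>Expansions in products of powers of t and 1 + t\<close>

lemma coeff_one_plus_t_power_nonneg: "0 \<le> coeff ([:1, 1:] ^ m :: int poly) k"
  by (induction m arbitrary: k) (auto simp: coeff_pCons split: nat.splits)

text \<open>Excludes cancellation between the terms of an expansion with positive
  coefficients.\<close>

lemma coeff_expansion_term_nonneg:
  "0 \<le> coeff (monom 1 i * [:1, 1:] ^ m :: int poly) k"
  by (simp add: coeff_monom_mult coeff_one_plus_t_power_nonneg)

text \<open>Induction on \<open>m\<close>: subtracting q(0) (1 + t)^m removes the constant term, and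
  the remainder is t times a polynomial to which the induction hypothesis applies.\<close>

lemma exists_expansion_le:
  fixes q :: "int poly"
  assumes "degree q \<le> m"
  shows "\<exists>b. q = (\<Sum>j\<le>m. smult (b j) (monom 1 j * [:1, 1:] ^ (m - j)))"
  using assms
proof (induction m arbitrary: q)
  case 0
  then obtain c where "q = [:c:]" by (metis degree_eq_zeroE le_zero_eq)
  then show ?case by (intro exI[of _ "\<lambda>_. c"]) (simp add: monom_0)
next
  case (Suc m)
  define r where "r = q - smult (coeff q 0) ([:1, 1:] ^ Suc m)"
  obtain c q' where r: "r = pCons c q'" by (rule pCons_cases)
  have "coeff r 0 = 0" by (simp only: r_def coeff_diff coeff_smult coeff_0_power) simp
  then have c: "c = 0" using r by simp
  have "degree r \<le> Suc m"
    unfolding r_def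
    by (intro degree_diff_le Suc.prems order_trans[OF degree_smult_le]) (simp only: degree_linear_power order_refl)
  then have "degree q' \<le> m" using r by (cases "q' = 0") auto
  from Suc.IH[OF this] obtain b where
    b: "q' = (\<Sum>j\<le>m. smult (b j) (monom 1 j * [:1, 1:] ^ (m - j)))" by blast
  have "q = smult (coeff q 0) ([:1, 1:] ^ Suc m) + monom 1 1 * q'"
    using r c by (simp add: r_def monom_altdef algebra_simps)
  also have "monom 1 1 * q' = (\<Sum>j\<le>m. smult (b j) (monom 1 (Suc j) * [:1, 1:] ^ (m - j)))"
    by (subst b) (simp add: sum_distrib_left mult_monom flip: mult.assoc)
  \<comment> \<open>Multiplication by t shifts the coefficients of \<open>q'\<close> up by one
    index, and \<open>coeff q 0\<close> takes index 0.\<close>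
  finally have "q = (\<Sum>j\<le>Suc m. smult (case_nat (coeff q 0) b j)
      (monom 1 j * [:1, 1:] ^ (Suc m - j)))"
    by (subst sum.atMost_Suc_shift) (simp del: power_Suc)
  then show ?case by (intro exI[of _ "case_nat (coeff q 0) b"])
qed

text \<open>Factor out t^d and expand the quotient, which has degree at most
  \<open>p - d\<close>.\<close>

lemma exists_expansion:
  fixes a :: "nat \<Rightarrow> int"
  assumes "d \<le> p"
  shows "\<exists>b. (\<Sum>i=d..p. monom (a i) i) = (\<Sum>i=d..p. smult (b i) (monom 1 i * [:1, 1:] ^ (p - i)))"
proof -
  define m where "m = p - d"
  have shift: "(\<Sum>i=d..p. g i) = (\<Sum>j\<le>m. g (j + d))" for g :: "nat \<Rightarrow> int poly"
    using assms sum.shift_bounds_cl_nat_ivl[of g 0 d m] by (simp add: m_def atLeast0AtMost)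
  have "degree (\<Sum>j\<le>m. monom (a (j + d)) j) \<le> m"
    by (intro degree_sum_le) (auto intro: order_trans[OF degree_monom_le])
  from exists_expansion_le[OF this] obtain b where
    b: "(\<Sum>j\<le>m. monom (a (j + d)) j) = (\<Sum>j\<le>m. smult (b j) (monom 1 j * [:1, 1:] ^ (m - j)))" by blast
  have "(\<Sum>i=d..p. monom (a i) i) = monom 1 d * (\<Sum>j\<le>m. monom (a (j + d)) j)"
    by (simp add: shift sum_distrib_left mult_monom add.commute)
  also have "\<dots> = (\<Sum>i=d..p. smult (b (i - d)) (monom 1 i * [:1, 1:] ^ (p - i)))"
    unfolding b shift sum_distrib_left
    by (intro sum.cong refl) (simp add: m_def mult_monom add.commute flip: mult.assoc)
  finally show ?thesis by (intro exI[of _ "\<lambda>i. b (i - d)"])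
qed

section \<open>Multiplication by (1 - t)^p\<close>

lemma geom_power_cancel:
  assumes "p \<le> m"
  shows "(1 - fps_X) ^ p * geom ^ m = geom ^ (m - p)"
proof -
  have "(1 - fps_X) ^ p * geom ^ m = ((1 - fps_X) * geom) ^ p * geom ^ (m - p)"
    using assms by (simp add: power_mult_distrib mult.assoc flip: power_add)
  then show ?thesis by (simp only: one_minus_X_geom power_one mult_1_left)
qed

lemma geom_power_nonneg: "0 \<le> (geom ^ m) $ k"
  by (induction m arbitrary: k) (auto simp: fps_mult_nth intro!: sum_nonneg)

text \<open>Multiplying by (1 - t)^p turns the first sum into the polynomial with coefficients
  \<open>b i\<close> and keeps the second divisible by t^(p+1), so the second does not reach degree
  \<open>j\<close>.\<close>

lemma expansion_coeff:
  assumes H: "H = (\<Sum>i=d..p. of_int (b i) * (fps_X ^ i * geom ^ p))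
      + (\<Sum>i=p+1..n. of_nat (a i) * (fps_X * geom) ^ i)"
    and j: "d \<le> j" "j \<le> p"
  shows "of_int (b j) = ((1 - fps_X) ^ p * H) $ j"
proof -
  have 1: "(1 - fps_X) ^ p * (of_int (b i) * (fps_X ^ i * geom ^ p)) = of_int (b i) * fps_X ^ i" for i
    using geom_power_cancel[of p p] by (simp add: mult_ac)
  have 2: "(1 - fps_X) ^ p * (of_nat (a i) * (fps_X * geom) ^ i) = of_nat (a i) * (fps_X ^ i * geom ^ (i - p))"
    if "i \<in> {p+1..n}" for i
    using geom_power_cancel[of p i] that by (simp add: mult_ac power_mult_distrib)
  have "(1 - fps_X) ^ p * H = (\<Sum>i=d..p. of_int (b i) * fps_X ^ i)
      + (\<Sum>i=p+1..n. of_nat (a i) * (fps_X ^ i * geom ^ (i - p)))"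
    unfolding H distrib_left sum_distrib_left 1 by (simp only: 2 cong: sum.cong)
  moreover have "(\<Sum>i=p+1..n. of_nat (a i) * (fps_X ^ i * geom ^ (i - p))) $ j = 0"
    using j by (simp add: fps_sum_nth fps_X_power_mult_nth)
  moreover have "(\<Sum>i=d..p. of_int (b i) * fps_X ^ i :: rat fps) $ j = of_int (b j)"
    using j by (simp add: fps_sum_nth if_distrib cong: if_cong)
  ultimately show ?thesis by simp
qed

text \<open>Since every summand has at least \<open>p\<close> variables, (1 - t)^p cancels against
  it and leaves t^s/(1 - t)^(|Z| - p), whose coefficients are nonnegative.\<close>

lemma decomp_series_nonneg:
  assumes "\<And>Z s. (Z, s) \<in> set D \<Longrightarrow> p \<le> card Z"
  shows "0 \<le> ((1 - fps_X) ^ p * decomp_series D) $ j"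
proof -
  have "(1 - fps_X) ^ p * (fps_X ^ snd (D ! i) * geom ^ card (fst (D ! i)))
      = fps_X ^ snd (D ! i) * geom ^ (card (fst (D ! i)) - p)" if "i \<in> {..<length D}" for i
    using geom_power_cancel[of p "card (fst (D ! i))"] assms[of "fst (D ! i)" "snd (D ! i)"] that
    by (simp add: mult_ac)
  then have "(1 - fps_X) ^ p * decomp_series D
      = (\<Sum>i<length D. fps_X ^ snd (D ! i) * geom ^ (card (fst (D ! i)) - p))"
    unfolding decomp_series_def sum_distrib_left by (intro sum.cong refl)
  then show ?thesis
    by (simp add: fps_sum_nth fps_X_power_mult_nth geom_power_nonneg sum_nonneg)
qed

subsection \<open>Hilbert series and Hilbert depth of squarefree monomial ideals\<close>

theorem theorem2p1:
  fixes I :: "('x::finite, 'k::field) mpoly set"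
    and u :: "nat \<Rightarrow> 'x mon" and s d n :: nat
    and a :: "nat \<Rightarrow> nat" and f :: "int poly"
  assumes n: "n = CARD('x)"
    and sqfree: "sqfree_monomial_ideal I" and proper: "I \<noteq> UNIV"
    and gens: "s \<ge> 1" "min_generated_by I s u"
    and d: "d = deg (u 1)" "1 \<le> d"
    and degs: "\<And>i j. 1 \<le> i \<Longrightarrow> i \<le> j \<Longrightarrow> j \<le> s \<Longrightarrow> deg (u i) \<le> deg (u j)"
    and a: "\<And>i. d \<le> i \<Longrightarrow> i \<le> n \<Longrightarrow> a i = num_sqfree I i"
    and f: "f = (\<Sum>i=d..n. Polynomial.monom (int (a i)) i)"
  shows
    "(hilbert_series I = (\<Sum>i=d..n. of_nat (a i) * fps_X ^ i / (1 - fps_X) ^ i)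
        \<and> hdepth I \<ge> d)
     \<and> (\<forall>(r::nat) (b :: nat \<Rightarrow> int) (\<alpha> :: nat \<Rightarrow> nat) (\<beta> :: nat \<Rightarrow> nat).
          (\<forall>j\<in>{1..r}. b j > 0 \<and> \<alpha> j \<ge> d) \<longrightarrow>
          f = (\<Sum>j=1..r. Polynomial.smult (b j) (Polynomial.monom 1 (\<alpha> j) * [:1, 1:] ^ \<beta> j)) \<longrightarrow>
          hilbert_series I =
            (\<Sum>j=1..r. of_int (b j) * fps_X ^ \<alpha> j / (1 - fps_X) ^ (\<alpha> j + \<beta> j))
          \<and> hdepth I \<ge> Min ((\<lambda>j. \<alpha> j + \<beta> j) ` {1..r}))
     \<and> (\<forall>p. d \<le> p \<longrightarrow> p \<le> n \<longrightarrow> hdepth I \<ge> p \<longrightarrow>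
          (let expansion = (\<lambda>b :: nat \<Rightarrow> int. f =
                 (\<Sum>i=d..p. Polynomial.smult (b i) (Polynomial.monom 1 i * [:1, 1:] ^ (p - i)))
                 + (\<Sum>i=p+1..n. Polynomial.monom (int (a i)) i))
           in (\<exists>!b. b \<in> {d..p} \<rightarrow>\<^sub>E {0..} \<and> expansion b)
              \<and> (\<forall>b \<in> {d..p} \<rightarrow>\<^sub>E {0..}. expansion b \<longrightarrow>
                   hilbert_series I =
                     (\<Sum>i=d..p. of_int (b i) * fps_X ^ i) / (1 - fps_X) ^ p
                     + (\<Sum>i=p+1..n. of_nat (a i) * fps_X ^ i / (1 - fps_X) ^ i))))"
proof (intro conjI allI impI)
  let ?H = "hilbert_series I"
  define M where "M = mon_multiples (u ` {1..s})"
  have gen: "I = mon_ideal (u ` {1..s})" using gens(2) by (simp add: min_generated_by_def)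
  then have I_M: "I = mon_space M" by (simp add: mon_ideal_eq_mon_space M_def)
  obtain G where G: "\<forall>g\<in>G. sqfree_mon g" "I = mon_ideal G"
    using sqfree by (auto simp: sqfree_monomial_ideal_def)
  have "mon_multiples G = M"
    unfolding M_def by (rule mon_multiples_eqI[where 'k = 'k]) (use gen G(2) in simp)
  \<comment> \<open>The first generator has least degree, and every monomial of \<open>I\<close> is
    divisible by some generator.\<close>
  moreover have d_le: "d \<le> deg w" if w: "w \<in> M" for w
  proof -
    obtain j where j: "j \<in> {1..s}" "\<forall>x. Poly_Mapping.lookup (u j) x \<le> Poly_Mapping.lookup w x"
      using w unfolding M_def mon_multiples_def by blast
    have "d \<le> deg (u j)" using degs[of 1 j] j(1) d(1) by simp
    also have "\<dots> \<le> deg w" by (rule deg_mono) (use j(2) in blast)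
    finally show ?thesis .
  qed
  ultimately have "?H = (\<Sum>i=d..n. of_nat (num_sqfree I i) * (fps_X * geom) ^ i)"
    unfolding n by (intro hilbert_series_sqfree[OF G(2,1)]) simp
  also have "\<dots> = (\<Sum>i=d..n. of_nat (a i) * (fps_X * geom) ^ i)"
    using a by (intro sum.cong refl) simp
  finally have H: "?H = (\<Sum>i=d..n. of_nat (a i) * (fps_X * geom) ^ i)" .
  have H_f: "?H = ev_geom f"
    unfolding H f by (simp add: ev_geom_sum ev_geom_monom)
  \<comment> \<open>The generator \<open>u 1\<close> makes the coefficient in degree
    \<open>d\<close> nonzero, so the Hilbert series does not vanish.\<close>
  have "u 1 \<in> M" using gens(1) by (auto simp: M_def mon_multiples_def)
  then have "{w \<in> M. deg w = d} \<noteq> {}" using d(1) by auto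
  then have "?H $ d \<noteq> 0"
    unfolding I_M hilbert_series_mon_space by (simp add: card_eq_0_iff)
  then have H_nz: "?H \<noteq> 0" by auto

  show H1: "?H = (\<Sum>i=d..n. of_nat (a i) * fps_X ^ i / (1 - fps_X) ^ i)"
    unfolding H by (simp add: divide_one_minus_X_power power_mult_distrib mult.assoc)
  have H1': "?H = (\<Sum>i\<in>{d..n}. of_nat (a i) * (fps_X ^ i * geom ^ i))"
    unfolding H by (simp add: power_mult_distrib)
  \<comment> \<open>Take \<open>a i\<close> summands with \<open>i\<close> variables and shift
    \<open>i\<close>. In the third claim \<open>D0\<close> serves again, to show that the depth is
    attained.\<close>
  obtain D0 where D0: "hilbert_decomp I D0" "d \<le> decomp_depth D0"
    by (rule hilbert_decomp_of_series[OF I_M _ H1' H_nz, of d]) (auto simp: n)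
  then show "hdepth I \<ge> d" by (rule le_hdepthI)

  {
    fix r :: nat and b :: "nat \<Rightarrow> int" and \<alpha> \<beta> :: "nat \<Rightarrow> nat"
    assume b: "\<forall>j\<in>{1..r}. b j > 0 \<and> \<alpha> j \<ge> d"
      and f_b: "f = (\<Sum>j=1..r. smult (b j) (monom 1 (\<alpha> j) * [:1, 1:] ^ \<beta> j))"
    have H2: "?H = (\<Sum>j=1..r. of_int (b j) * (fps_X ^ \<alpha> j * geom ^ (\<alpha> j + \<beta> j)))"
      unfolding H_f f_b by (simp add: ev_geom_sum ev_geom_term)
    then show "?H = (\<Sum>j=1..r. of_int (b j) * fps_X ^ \<alpha> j / (1 - fps_X) ^ (\<alpha> j + \<beta> j))"
      by (simp add: divide_one_minus_X_power mult.assoc)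
    \<comment> \<open>As multiplicities of summands, the positive integers \<open>b j\<close> must
      be read as natural numbers.\<close>
    have "of_int (b j) = (of_nat (nat (b j)) :: rat fps)" if "j \<in> {1..r}" for j
      using b that by (simp add: of_nat_nat less_imp_le)
    with H2 have H2': "?H = (\<Sum>j\<in>{1..r}. of_nat (nat (b j)) * (fps_X ^ \<alpha> j * geom ^ (\<alpha> j + \<beta> j)))"
      by simp
    \<comment> \<open>Summands with \<alpha> j + \<beta> j variables must exist. The term for
      \<open>j\<close> contributes \<open>b j > 0\<close> in that degree, nothing cancels it, and
      \<open>f\<close> has no coefficients beyond degree \<open>n\<close>.\<close>
    have le_n: "\<alpha> j + \<beta> j \<le> n" if j: "j \<in> {1..r}" for j
    proof (rule ccontr)
      let ?c = "\<lambda>i. coeff (smult (b i) (monom 1 (\<alpha> i) * [:1, 1:] ^ \<beta> i)) (\<alpha> j + \<beta> j)"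
      assume "\<not> \<alpha> j + \<beta> j \<le> n"
      then have "coeff f (\<alpha> j + \<beta> j) = 0" unfolding f by (simp add: coeff_sum)
      then have "(\<Sum>i=1..r. ?c i) = 0" unfolding f_b by (simp only: coeff_sum)
      moreover have "0 \<le> ?c i" if "i \<in> {1..r}" for i
        using b that coeff_expansion_term_nonneg by (simp add: less_imp_le)
      ultimately have "?c j = 0" using j by (subst (asm) sum_nonneg_eq_0_iff) auto
      moreover have "coeff ([:1, 1:] ^ \<beta> j :: int poly) (\<beta> j) = 1"
        using lead_coeff_power[of "[:1, 1:] :: int poly" "\<beta> j"] by (simp add: degree_linear_power)
      ultimately show False using bspec[OF b j] by (simp add: coeff_monom_mult)
    qed
    \<comment> \<open>An empty expansion would make the Hilbert series zero; hence the
      \<open>Min\<close> below is over a nonempty set.\<close>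
    have "{1..r} \<noteq> {}"
    proof
      assume "{1..r} = {}"
      then have "?H = 0" using H2 by (simp only: sum.empty)
      then show False using H_nz by contradiction
    qed
    obtain D where "hilbert_decomp I D" "Min ((\<lambda>j. \<alpha> j + \<beta> j) ` {1..r}) \<le> decomp_depth D"
      by (rule hilbert_decomp_of_series[OF I_M _ H2' H_nz, of "Min ((\<lambda>j. \<alpha> j + \<beta> j) ` {1..r})"])
        (use le_n n in auto)
    then show "hdepth I \<ge> Min ((\<lambda>j. \<alpha> j + \<beta> j) ` {1..r})" by (rule le_hdepthI)
  }

  fix p assume dp: "d \<le> p" and pn: "p \<le> n" and depth: "hdepth I \<ge> p"
  define expansion where "expansion = (\<lambda>b :: nat \<Rightarrow> int. f =
    (\<Sum>i=d..p. smult (b i) (monom 1 i * [:1, 1:] ^ (p - i))) + (\<Sum>i=p+1..n. monom (int (a i)) i))"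
  have H3: "?H = (\<Sum>i=d..p. of_int (b i) * (fps_X ^ i * geom ^ p))
      + (\<Sum>i=p+1..n. of_nat (a i) * (fps_X * geom) ^ i)" if "expansion b" for b
    unfolding H_f that[unfolded expansion_def]
    by (simp add: ev_geom_add ev_geom_sum ev_geom_term ev_geom_monom)
  note coeff_b = expansion_coeff[OF H3]
  obtain D where D: "hilbert_decomp I D" "\<And>Z s. (Z, s) \<in> set D \<Longrightarrow> p \<le> card Z"
    using le_hdepthE[OF depth D0(1)] by blast
  have H_D: "?H = decomp_series D"
    using D(1) unfolding I_M hilbert_decomp_mon_space_iff .
  \<comment> \<open>\<open>b j\<close> is a coefficient of (1 - t)^p H(t), and H is also the series
    of a decomposition whose summands all have at least \<open>p\<close> variables.\<close>
  have nonneg: "0 \<le> b j" if "expansion b" "j \<in> {d..p}" for b j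
  proof -
    have "(0 :: rat) \<le> of_int (b j)"
      using coeff_b[OF that(1), of j] that(2) decomp_series_nonneg[of D p j] D(2) H_D by simp
    then show ?thesis by simp
  qed
  obtain b0 where b0: "(\<Sum>i=d..p. monom (int (a i)) i) = (\<Sum>i=d..p. smult (b0 i) (monom 1 i * [:1, 1:] ^ (p - i)))"
    using exists_expansion[OF dp, of "\<lambda>i. int (a i)"] by blast
  have "{d..n} = {d..p} \<union> {p+1..n}" using dp pn by auto
  then have "f = (\<Sum>i=d..p. monom (int (a i)) i) + (\<Sum>i=p+1..n. monom (int (a i)) i)"
    unfolding f by (simp add: sum.union_disjoint)
  \<comment> \<open>Only the values on \<open>{d..p}\<close> enter \<open>expansion\<close>;
    restricting to them makes the solution extensional, as uniqueness demands.\<close>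
  then have b0': "expansion (restrict b0 {d..p})"
    unfolding expansion_def b0 by simp
  have unique: "\<exists>!b. b \<in> {d..p} \<rightarrow>\<^sub>E {0..} \<and> expansion b"
  proof (rule ex1I[of _ "restrict b0 {d..p}"])
    show "restrict b0 {d..p} \<in> {d..p} \<rightarrow>\<^sub>E {0..} \<and> expansion (restrict b0 {d..p})"
      using b0' nonneg[OF b0'] by (auto simp: PiE_def Pi_def)
    fix b assume b: "b \<in> {d..p} \<rightarrow>\<^sub>E {0..} \<and> expansion b"
    show "b = restrict b0 {d..p}"
    proof (rule extensionalityI)
      show "b \<in> extensional {d..p}" using b by (simp add: PiE_def)
      fix j assume j: "j \<in> {d..p}"
      \<comment> \<open>Both values are the same coefficient of (1 - t)^p H(t).\<close>
      have "(of_int (b j) :: rat) = of_int (restrict b0 {d..p} j)"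
        using coeff_b[of b j] coeff_b[OF b0', of j] b j by simp
      then show "b j = restrict b0 {d..p} j" by simp
    qed simp
  qed
  have "?H = (\<Sum>i=d..p. of_int (b i) * fps_X ^ i) / (1 - fps_X) ^ p
      + (\<Sum>i=p+1..n. of_nat (a i) * fps_X ^ i / (1 - fps_X) ^ i)" if "expansion b" for b
    by (subst H3[OF that])
      (simp add: divide_one_minus_X_power sum_distrib_right power_mult_distrib mult.assoc)
  with unique show "let expansion = (\<lambda>b :: nat \<Rightarrow> int. f =
        (\<Sum>i=d..p. smult (b i) (monom 1 i * [:1, 1:] ^ (p - i))) + (\<Sum>i=p+1..n. monom (int (a i)) i))
      in (\<exists>!b. b \<in> {d..p} \<rightarrow>\<^sub>E {0..} \<and> expansion b)
         \<and> (\<forall>b \<in> {d..p} \<rightarrow>\<^sub>E {0..}. expansion b \<longrightarrow>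
              ?H = (\<Sum>i=d..p. of_int (b i) * fps_X ^ i) / (1 - fps_X) ^ p
                + (\<Sum>i=p+1..n. of_nat (a i) * fps_X ^ i / (1 - fps_X) ^ i))"
    unfolding expansion_def[symmetric] Let_def by blast
qed

end
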